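(* Let $K_1$ be a Cantor set in $\mathbb{R}^d$ and let $g_0\in C^1_{\mathsf{inv}}(\mathbb{R}^d)$. Then there exist $\varepsilon>0$ and a Cantor set $K_2\subset\mathbb{R}^d$ such that $$\left(\bigcap_{g\in\mathsf{B}^{\mathsf d}_{\varepsilon}(g_0)}\big(g(K_1)+K_2\big)\right)^{\circ}\neq\varnothing .$$
   Context: A Cantor set in $\mathbb{R}^d$ is a (non-empty) compact, totally disconnected, perfect subset of $\mathbb{R}^d$. $E^\circ$ denotes the interior of $E$, and $A+B=\{a+b:a\in A,b\in B\}$. $C^1(\mathbb{R}^d)$ is the set of continuously differentiable maps $g=(g_1,\dots,g_d):\mathbb{R}^d\to\mathbb{R}^d$; $J_g(x)$ is the Jacobian matrix of $g$ at $x$; $C^1_{\mathsf{inv}}(\mathbb{R}^d)=\{g\in C^1(\mathbb{R}^d): J_g(x)\text{ is invertible for all }x\in\mathbb{R}^d\}$. Fix an increasing sequence of compact sets $R_1\subset R_2\subset\cdots$ with $\bigcup_n R_n=\mathbb{R}^d$ and $R_n\subset R_{n+1}^\circ$. For $g\in C^1(\mathbb{R}^d)$ put $$\|g\|_{n,\infty}=\max_{x\in R_n}|g(x)|+\Big(\sum_{i,j=1}^d\big(\max_{x\in R_n}\big|\tfrac{\partial g_j}{\partial x_i}(x)\big|\big)^2\Big)^{1/2},\qquad \mathsf d(f,g)=\sum_{n=1}^\infty 2^{-n}\frac{\|f-g\|_{n,\infty}}{1+\|f-g\|_{n,\infty}}.$$ This is a metric on $C^1(\mathbb{R}^d)$,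 giving local uniform convergence of functions and first derivatives, and $\mathsf B^{\mathsf d}_\varepsilon(f)=\{g\in C^1(\mathbb{R}^d):\mathsf d(f,g)<\varepsilon\}$. *)

theory Defs
  imports "HOL-Analysis.Analysis"
begin

definition totally_disconnected :: "'a::topological_space set \<Rightarrow> bool" where
  "totally_disconnected S \<longleftrightarrow> (\<forall>x\<in>S. connected_component_set S x = {x})"

text \<open>A perfect set is a closed set without isolated points.\<close>

definition perfect_set :: "'a::topological_space set \<Rightarrow> bool" where
  "perfect_set S \<longleftrightarrow> closed S \<and> (\<forall>x\<in>S. x islimpt S)"

definition cantor_set :: "'a::topological_space set \<Rightarrow> bool" where
  "cantor_set K \<longleftrightarrow> K \<noteq> {} \<and> compact K \<and> totally_disconnected K \<and> perfect_set K"

definition C1_maps :: "(real ^ 'n \<Rightarrow> real ^ 'n) set" where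
  "C1_maps = {g. (\<forall>x. g differentiable (at x)) \<and> continuous_on UNIV (\<lambda>x. jacobian g (at x))}"

definition C1_inv :: "(real ^ 'n \<Rightarrow> real ^ 'n) set" where
  "C1_inv = {g \<in> C1_maps. \<forall>x. invertible (jacobian g (at x))}"

text \<open>
  The sequence is indexed from \<open>1\<close>; the value \<open>R 0\<close> is irrelevant.
  Nonemptiness makes the maxima over \<open>R n\<close> meaningful.
\<close>

definition compact_exhaustion :: "(nat \<Rightarrow> 'a::topological_space set) \<Rightarrow> bool" where
  "compact_exhaustion R \<longleftrightarrow>
     (\<forall>n\<ge>1. compact (R n) \<and> R n \<noteq> {} \<and> R n \<subseteq> R (Suc n) \<and> R n \<subseteq> interior (R (Suc n))) \<and>
     (\<Union>n\<in>{1..}. R n) = UNIV"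

text \<open>
  The suprema are maxima whenever \<open>g\<close> is continuously differentiable and \<open>R n\<close> is compact and
  nonempty. The partial derivative of the \<open>j\<close>-th component in direction \<open>i\<close> is the entry in
  row \<open>j\<close> and column \<open>i\<close> of the Jacobian matrix.
\<close>

definition C1_norm :: "(nat \<Rightarrow> (real ^ 'n) set) \<Rightarrow> nat \<Rightarrow> (real ^ 'n \<Rightarrow> real ^ 'n) \<Rightarrow> real" where
  "C1_norm R n g =
     (SUP x\<in>R n. norm (g x)) +
     sqrt (\<Sum>i\<in>UNIV. \<Sum>j\<in>UNIV. (SUP x\<in>R n. \<bar>jacobian g (at x) $ j $ i\<bar>)\<^sup>2)"

text \<open>The sum over \<open>n \<ge> 1\<close> is written as a series over \<open>Suc n\<close>.\<close>

definition C1_dist ::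
  "(nat \<Rightarrow> (real ^ 'n) set) \<Rightarrow> (real ^ 'n \<Rightarrow> real ^ 'n) \<Rightarrow> (real ^ 'n \<Rightarrow> real ^ 'n) \<Rightarrow> real" where
  "C1_dist R f g =
     (\<Sum>n. 1 / 2 ^ Suc n *
        (C1_norm R (Suc n) (\<lambda>x. f x - g x) / (1 + C1_norm R (Suc n) (\<lambda>x. f x - g x))))"

definition C1_ball ::
  "(nat \<Rightarrow> (real ^ 'n) set) \<Rightarrow> (real ^ 'n \<Rightarrow> real ^ 'n) \<Rightarrow> real \<Rightarrow> (real ^ 'n \<Rightarrow> real ^ 'n) set" where
  "C1_ball R f \<epsilon> = {g \<in> C1_maps. C1_dist R f g < \<epsilon>}"

end

theory Submission
  imports Defs
begin

text \<open>
  Near a point of \<open>K1\<close> every \<open>g\<close> close to \<open>g0\<close> is, on differences, a small perturbation of one fixed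
  invertible linear map \<open>J\<close>. Colour each pair \<open>a \<noteq> b\<close> in \<open>K1\<close> by a dominant coordinate \<open>k\<close> of \<open>J (a - b)\<close>;
  by finiteness some relatively open piece \<open>S\<close> of \<open>K1\<close> carries pairs of a single colour \<open>k\<close> at every
  point and every scale. All functionals \<open>2 x\<^sub>k + x\<^sub>i\<close> then separate \<open>g a\<close> from \<open>g b\<close> for each such pair,
  uniformly in \<open>g\<close>. These \<open>d\<close> functionals are linearly independent, so removing from space, at the
  \<open>n\<close>-th stage, the slabs where one of them is \<open>\<delta>\<^sub>n\<close>-close to a multiple of \<open>\<rho>\<^sub>n\<close> (each functional
  occurring with arbitrarily small \<open>\<rho>\<^sub>n\<close>) leaves a totally disconnected set. If a pair is much closer
  together than \<open>\<rho>\<^sub>n\<close>, and \<open>\<delta>\<^sub>n\<close> is small compared with its separation, then \<open>t - g a\<close> and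
  \<open>t - g b\<close> cannot both be removed. By compactness \<open>\<delta>\<^sub>n\<close> can be chosen uniformly, and nested balls give
  points \<open>q\<close> of \<open>K1\<close> for which \<open>t - g q\<close> survives all stages; \<open>K2\<close> is the closure of these survivors.
\<close>

section \<open>Neighbourhoods of arithmetic progressions\<close>

text \<open>The inequality is non-strict so that the condition is closed and passes to the closure
  that defines \<open>K2\<close>.\<close>

definition away_from_multiples :: "real \<Rightarrow> real \<Rightarrow> real \<Rightarrow> bool" where
  "away_from_multiples \<delta> \<rho> y \<longleftrightarrow> (\<forall>m::int. \<delta> \<le> \<bar>y - of_int m * \<rho>\<bar>)"

lemma away_from_multiples_mono:
  "away_from_multiples \<delta> \<rho> y \<Longrightarrow> \<delta>' \<le> \<delta> \<Longrightarrow> away_from_multiples \<delta>' \<rho> y"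
  unfolding away_from_multiples_def by (meson order_trans)

lemma away_from_multiples_perturb:
  assumes "away_from_multiples \<delta> \<rho> y" "\<bar>y' - y\<bar> \<le> \<delta> / 2"
  shows "away_from_multiples (\<delta> / 2) \<rho> y'"
  unfolding away_from_multiples_def
proof
  fix m :: int
  have "\<delta> \<le> \<bar>y - of_int m * \<rho>\<bar>" using assms(1) unfolding away_from_multiples_def by blast
  then show "\<delta> / 2 \<le> \<bar>y' - of_int m * \<rho>\<bar>" using assms(2) by linarith
qed

text \<open>If both values failed, each would be \<open>\<delta>\<close>-close to a multiple of
  \<open>\<rho>\<close>. A common multiple would put them less than \<open>2 * \<delta>\<close>
  apart; distinct multiples would put them more than \<open>\<rho> - 2 * \<delta>\<close>, hence
  more than \<open>\<rho> / 2\<close>, apart.\<close>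

lemma away_from_multiples_either:
  assumes "\<rho> > 0" "2 * \<delta> \<le> \<bar>u - v\<bar>" "\<bar>u - v\<bar> \<le> \<rho> / 2" "4 * \<delta> \<le> \<rho>"
  shows "away_from_multiples \<delta> \<rho> u \<or> away_from_multiples \<delta> \<rho> v"
proof (rule ccontr)
  assume "\<not> ?thesis"
  then obtain m n :: int where m: "\<bar>u - of_int m * \<rho>\<bar> < \<delta>" and n: "\<bar>v - of_int n * \<rho>\<bar> < \<delta>"
    unfolding away_from_multiples_def by (auto simp: not_le)
  show False
  proof (cases "m = n")
    case True
    moreover from m n have "\<bar>u - v\<bar> < 2 * \<delta>" unfolding True abs_less_iff by linarith
    ultimately show False using assms by simp
  next
    case False
    then have "1 \<le> \<bar>real_of_int (m - n)\<bar>" by linarith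
    then have "\<rho> \<le> \<bar>real_of_int (m - n)\<bar> * \<rho>" using assms(1) by simp
    also have "\<dots> = \<bar>of_int m * \<rho> - of_int n * \<rho>\<bar>"
      using assms(1) by (simp add: abs_mult flip: left_diff_distrib)
    finally show False using m n assms by linarith
  qed
qed

lemma closed_away_from_multiples: "closed {y. away_from_multiples \<delta> \<rho> y}"
proof -
  have "{y. away_from_multiples \<delta> \<rho> y} = (\<Inter>m::int. {y. \<delta> \<le> \<bar>y - of_int m * \<rho>\<bar>})"
    unfolding away_from_multiples_def by auto
  moreover have "closed {y. \<delta> \<le> \<bar>y - of_int m * \<rho>\<bar>}" for m :: int
    by (intro closed_Collect_le continuous_intros)
  ultimately show ?thesis by auto
qed

text \<open>A connected subset of the line containing two points more than \<open>\<rho>\<close>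
  apart contains the first multiple of \<open>\<rho>\<close> to the right of the lower one, which is
  excluded. This is the source of the total disconnectedness of \<open>K2\<close>.\<close>

lemma connected_away_from_multiples:
  assumes "connected C" "\<And>y. y \<in> C \<Longrightarrow> away_from_multiples \<delta> \<rho> y"
    and "\<delta> > 0" "\<rho> > 0" "x \<in> C" "y \<in> C"
  shows "\<bar>x - y\<bar> \<le> \<rho>"
proof -
  have *: "v - u \<le> \<rho>" if uv: "u \<in> C" "v \<in> C" for u v
  proof (rule ccontr)
    assume "\<not> v - u \<le> \<rho>"
    then have gt: "u + \<rho> < v" by simp
    define m where "m = \<lceil>u / \<rho>\<rceil>"
    have "u / \<rho> \<le> of_int m" "of_int m < u / \<rho> + 1" unfolding m_def by linarith+
    then have "u \<le> of_int m * \<rho>" "of_int m * \<rho> \<le> u + \<rho>"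
      using assms(4) by (auto simp: field_simps)
    with gt have "of_int m * \<rho> \<in> C"
      using connectedD_interval[OF assms(1) uv] by auto
    from assms(2)[OF this] have "\<delta> \<le> \<bar>of_int m * \<rho> - of_int m * \<rho>\<bar>"
      unfolding away_from_multiples_def by blast
    then show False using assms(3) by simp
  qed
  show ?thesis using *[of x y] *[of y x] assms(5,6) by linarith
qed

section \<open>Avoiding progressions along a set\<close>

text \<open>One of the two points of a separated pair always survives. Since the separation
  \<open>\<mu>\<close> is common to all of \<open>\<Phi>\<close>, so is \<open>\<delta>\<close>;
  which point survives may depend on \<open>\<phi>\<close>.\<close>

lemma avoid_near_point:
  fixes S :: "'a::metric_space set" and \<Phi> :: "('a \<Rightarrow> real) set"
  assumes pairs: "\<And>x r. x \<in> S \<Longrightarrow> r > 0 \<Longrightarrow>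
      \<exists>a\<in>S \<inter> ball x r. \<exists>b\<in>S \<inter> ball x r. \<exists>\<mu>>0. \<forall>\<phi>\<in>\<Phi>. \<mu> \<le> \<bar>\<phi> a - \<phi> b\<bar>"
    and lip: "\<And>\<phi> x y. \<phi> \<in> \<Phi> \<Longrightarrow> x \<in> S \<Longrightarrow> y \<in> S \<Longrightarrow> \<bar>\<phi> x - \<phi> y\<bar> \<le> L * dist x y"
    and "x \<in> S" "r > 0" "\<rho> > 0" "L > 0"
  shows "\<exists>\<delta>>0. \<forall>\<phi>\<in>\<Phi>. \<exists>y\<in>S \<inter> ball x r. away_from_multiples \<delta> \<rho> (\<phi> y)"
proof -
  \<comment> \<open>Two points of \<open>ball x s\<close> are at most \<open>2 * s\<close> apart, so
    the Lipschitz bound keeps their values within \<open>\<rho> / 2\<close>.\<close>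
  define s where "s = min r (\<rho> / (4 * L))"
  have "s > 0" unfolding s_def using assms by simp
  then obtain a b \<mu> where a: "a \<in> S" "dist x a < s" and b: "b \<in> S" "dist x b < s"
    and \<mu>: "\<mu> > 0" "\<forall>\<phi>\<in>\<Phi>. \<mu> \<le> \<bar>\<phi> a - \<phi> b\<bar>"
    using pairs[OF \<open>x \<in> S\<close>] by (metis IntE mem_ball)
  define \<delta> where "\<delta> = min (\<mu> / 2) (\<rho> / 4)"
  have "dist a b \<le> 2 * s"
    using a(2) b(2) dist_triangle3[of a b x] by linarith
  also have "\<dots> \<le> 2 * (\<rho> / (4 * L))" unfolding s_def by simp
  finally have Lab: "L * dist a b \<le> \<rho> / 2" using \<open>L > 0\<close> by (simp add: field_simps)
  have "\<exists>y\<in>S \<inter> ball x r. away_from_multiples \<delta> \<rho> (\<phi> y)" if "\<phi> \<in> \<Phi>" for \<phi>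
  proof -
    have "away_from_multiples \<delta> \<rho> (\<phi> a) \<or> away_from_multiples \<delta> \<rho> (\<phi> b)"
    proof (rule away_from_multiples_either[OF \<open>\<rho> > 0\<close>])
      show "2 * \<delta> \<le> \<bar>\<phi> a - \<phi> b\<bar>" using \<mu> that unfolding \<delta>_def by fastforce
      show "\<bar>\<phi> a - \<phi> b\<bar> \<le> \<rho> / 2" using lip[OF that a(1) b(1)] Lab by linarith
      show "4 * \<delta> \<le> \<rho>" unfolding \<delta>_def by linarith
    qed
    then show ?thesis using a b unfolding s_def by auto
  qed
  moreover have "\<delta> > 0" using \<mu> assms unfolding \<delta>_def by simp
  ultimately show ?thesis by blast
qed

text \<open>Staying away from an arbitrary \<open>z\<close> is what later makes the surviving points accumulate.\<close>

lemma avoid_near_point_and_value: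
  fixes S :: "'a::metric_space set" and \<Phi> :: "('a \<Rightarrow> real) set"
  assumes pairs: "\<And>x r. x \<in> S \<Longrightarrow> r > 0 \<Longrightarrow>
      \<exists>a\<in>S \<inter> ball x r. \<exists>b\<in>S \<inter> ball x r. \<exists>\<mu>>0. \<forall>\<phi>\<in>\<Phi>. \<mu> \<le> \<bar>\<phi> a - \<phi> b\<bar>"
    and lip: "\<And>\<phi> x y. \<phi> \<in> \<Phi> \<Longrightarrow> x \<in> S \<Longrightarrow> y \<in> S \<Longrightarrow> \<bar>\<phi> x - \<phi> y\<bar> \<le> L * dist x y"
    and limpt: "\<And>x. x \<in> S \<Longrightarrow> x islimpt S"
    and "x \<in> S" "r > 0" "\<rho> > 0" "L > 0"
  shows "\<exists>\<delta>>0. \<forall>z. \<forall>\<phi>\<in>\<Phi>. \<exists>y\<in>S \<inter> ball x r. away_from_multiples \<delta> \<rho> (\<phi> y) \<and> \<delta> \<le> dist y z"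
proof -
  obtain x' where x': "x' \<in> S" "x' \<noteq> x" "dist x' x < r / 2"
    using limpt[OF \<open>x \<in> S\<close>] \<open>r > 0\<close> unfolding islimpt_approachable by (meson half_gt_zero)
  \<comment> \<open>The centres \<open>x\<close> and \<open>x'\<close> are \<open>4 * s\<close>
    apart, so points chosen in their \<open>s\<close>-balls are at least \<open>2 * s\<close> apart,
    and \<open>z\<close> cannot be closer than \<open>s\<close> to both.\<close>
  define s where "s = dist x' x / 4"
  have s: "s > 0" "s < r / 8" using x' unfolding s_def by auto
  obtain \<delta>1 where \<delta>1: "\<delta>1 > 0"
    "\<forall>\<phi>\<in>\<Phi>. \<exists>y\<in>S \<inter> ball x s. away_from_multiples \<delta>1 \<rho> (\<phi> y)"
    using avoid_near_point[OF pairs lip \<open>x \<in> S\<close> \<open>s > 0\<close> \<open>\<rho> > 0\<close> \<open>L > 0\<close>] by blast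
  obtain \<delta>2 where \<delta>2: "\<delta>2 > 0"
    "\<forall>\<phi>\<in>\<Phi>. \<exists>y\<in>S \<inter> ball x' s. away_from_multiples \<delta>2 \<rho> (\<phi> y)"
    using avoid_near_point[OF pairs lip \<open>x' \<in> S\<close> \<open>s > 0\<close> \<open>\<rho> > 0\<close> \<open>L > 0\<close>] by blast
  define \<delta> where "\<delta> = min s (min \<delta>1 \<delta>2)"
  have "\<exists>y\<in>S \<inter> ball x r. away_from_multiples \<delta> \<rho> (\<phi> y) \<and> \<delta> \<le> dist y z" if "\<phi> \<in> \<Phi>" for \<phi> z
  proof -
    obtain y1 where y1: "y1 \<in> S" "dist x y1 < s" "away_from_multiples \<delta>1 \<rho> (\<phi> y1)"
      using \<delta>1 \<open>\<phi> \<in> \<Phi>\<close> by (metis IntE mem_ball)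
    obtain y2 where y2: "y2 \<in> S" "dist x' y2 < s" "away_from_multiples \<delta>2 \<rho> (\<phi> y2)"
      using \<delta>2 \<open>\<phi> \<in> \<Phi>\<close> by (metis IntE mem_ball)
    have "4 * s \<le> dist x' y2 + dist y2 y1 + dist x y1"
      using dist_triangle[of x' x y2] dist_triangle[of y2 x y1] unfolding s_def
      by (simp add: dist_commute)
    then have "2 * s \<le> dist y1 z + dist y2 z"
      using y1 y2 dist_triangle2[of y2 y1 z] by linarith
    then consider "s \<le> dist y1 z" | "s \<le> dist y2 z" by linarith
    then show ?thesis
    proof cases
      case 1
      have "dist x y1 < r" using y1 s by linarith
      with 1 y1 show ?thesis
        by (intro bexI[of _ y1]) (auto simp: \<delta>_def intro: away_from_multiples_mono)
    next
      case 2
      have "dist x y2 < r" using y2 s x' dist_triangle[of x y2 x'] \<open>r > 0\<close>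
        by (simp add: dist_commute)
      with 2 y2 show ?thesis
        by (intro bexI[of _ y2]) (auto simp: \<delta>_def intro: away_from_multiples_mono)
    qed
  qed
  moreover have "\<delta> > 0" using s \<delta>1 \<delta>2 unfolding \<delta>_def by simp
  ultimately show ?thesis by blast
qed

text \<open>Finitely many balls of radius \<open>r / 2\<close> with centres in \<open>S\<close>
  cover the compact closure. The ball of radius \<open>r\<close> about any point of \<open>S\<close>
  contains one of them, so the least of finitely many margins works everywhere.\<close>

lemma avoid_uniformly:
  fixes S :: "'a::metric_space set" and \<Phi> :: "('a \<Rightarrow> real) set"
  assumes pairs: "\<And>x r. x \<in> S \<Longrightarrow> r > 0 \<Longrightarrow>
      \<exists>a\<in>S \<inter> ball x r. \<exists>b\<in>S \<inter> ball x r. \<exists>\<mu>>0. \<forall>\<phi>\<in>\<Phi>. \<mu> \<le> \<bar>\<phi> a - \<phi> b\<bar>"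
    and lip: "\<And>\<phi> x y. \<phi> \<in> \<Phi> \<Longrightarrow> x \<in> S \<Longrightarrow> y \<in> S \<Longrightarrow> \<bar>\<phi> x - \<phi> y\<bar> \<le> L * dist x y"
    and limpt: "\<And>x. x \<in> S \<Longrightarrow> x islimpt S"
    and "compact (closure S)" "r > 0" "\<rho> > 0" "L > 0"
  shows "\<exists>\<delta>>0. \<forall>x\<in>S. \<forall>z. \<forall>\<phi>\<in>\<Phi>.
    \<exists>y\<in>S \<inter> ball x r. away_from_multiples \<delta> \<rho> (\<phi> y) \<and> \<delta> \<le> dist y z"
proof -
  have "closure S \<subseteq> (\<Union>c\<in>S. ball c (r / 2))"
  proof
    fix x assume "x \<in> closure S"
    then obtain c where "c \<in> S" "dist c x < r / 2"
      using \<open>r > 0\<close> unfolding closure_approachable by (meson half_gt_zero)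
    then show "x \<in> (\<Union>c\<in>S. ball c (r / 2))" by auto
  qed
  then obtain C where C: "C \<subseteq> S" "finite C" "closure S \<subseteq> (\<Union>c\<in>C. ball c (r / 2))"
    using compactE_image[OF \<open>compact (closure S)\<close>, of S "\<lambda>c. ball c (r / 2)"] by auto
  have "\<forall>c\<in>C. \<exists>\<delta>>0. \<forall>z. \<forall>\<phi>\<in>\<Phi>.
    \<exists>y\<in>S \<inter> ball c (r / 2). away_from_multiples \<delta> \<rho> (\<phi> y) \<and> \<delta> \<le> dist y z"
  proof
    fix c assume "c \<in> C"
    then have "c \<in> S" using C(1) by blast
    then show "\<exists>\<delta>>0. \<forall>z. \<forall>\<phi>\<in>\<Phi>.
        \<exists>y\<in>S \<inter> ball c (r / 2). away_from_multiples \<delta> \<rho> (\<phi> y) \<and> \<delta> \<le> dist y z"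
      using avoid_near_point_and_value[OF pairs lip limpt _ half_gt_zero[OF \<open>r > 0\<close>] \<open>\<rho> > 0\<close> \<open>L > 0\<close>]
      by blast
  qed
  from bchoice[OF this] obtain d where "\<forall>c\<in>C. d c > 0 \<and> (\<forall>z. \<forall>\<phi>\<in>\<Phi>.
      \<exists>y\<in>S \<inter> ball c (r / 2). away_from_multiples (d c) \<rho> (\<phi> y) \<and> d c \<le> dist y z)" ..
  then have d: "\<And>c. c \<in> C \<Longrightarrow> d c > 0"
    "\<And>c z \<phi>. c \<in> C \<Longrightarrow> \<phi> \<in> \<Phi> \<Longrightarrow>
      \<exists>y\<in>S \<inter> ball c (r / 2). away_from_multiples (d c) \<rho> (\<phi> y) \<and> d c \<le> dist y z"
    by auto
  \<comment> \<open>The extra element 1 keeps the minimum meaningful when \<open>C\<close> is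
    empty.\<close>
  define \<delta> where "\<delta> = Min (insert 1 (d ` C))"
  have "\<delta> > 0" unfolding \<delta>_def using C(2) d(1) by auto
  moreover have "\<exists>y\<in>S \<inter> ball x r. away_from_multiples \<delta> \<rho> (\<phi> y) \<and> \<delta> \<le> dist y z"
    if "x \<in> S" "\<phi> \<in> \<Phi>" for x z \<phi>
  proof -
    obtain c where c: "c \<in> C" "dist c x < r / 2"
      using C(3) closure_subset[of S] \<open>x \<in> S\<close> by (fastforce simp: subset_iff)
    obtain y where y: "y \<in> S" "dist c y < r / 2" "away_from_multiples (d c) \<rho> (\<phi> y)" "d c \<le> dist y z"
      using d(2)[OF c(1) \<open>\<phi> \<in> \<Phi>\<close>] by (metis IntE mem_ball)
    have "\<delta> \<le> d c" unfolding \<delta>_def using C(2) c(1) by simp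
    moreover have "dist x y < r" using c y dist_triangle3[of x y c] by linarith
    ultimately show ?thesis using y
      by (intro bexI[of _ y]) (auto intro: away_from_multiples_mono)
  qed
  ultimately show ?thesis by blast
qed

text \<open>Radii and margins are fixed by one recursion before any \<open>\<pi>\<close> is
  considered, so a single sequence \<open>\<delta>\<close> serves all of \<open>P\<close>; only the
  nested balls depend on \<open>\<pi>\<close>. Their centres stay in \<open>S\<close>, where
  separated pairs are available, but the limits lie in \<open>closure S\<close>, so the Lipschitz
  bound is assumed there.\<close>

lemma exists_avoiding_perfect_subset:
  fixes S :: "'a::metric_space set" and \<phi> :: "'p \<Rightarrow> nat \<Rightarrow> 'a \<Rightarrow> real"
  assumes pairs: "\<And>n x r. x \<in> S \<Longrightarrow> r > 0 \<Longrightarrow>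
      \<exists>a\<in>S \<inter> ball x r. \<exists>b\<in>S \<inter> ball x r. \<exists>\<mu>>0. \<forall>\<pi>\<in>P. \<mu> \<le> \<bar>\<phi> \<pi> n a - \<phi> \<pi> n b\<bar>"
    and lip: "\<And>\<pi> n x y. \<pi> \<in> P \<Longrightarrow> x \<in> closure S \<Longrightarrow> y \<in> closure S \<Longrightarrow>
      \<bar>\<phi> \<pi> n x - \<phi> \<pi> n y\<bar> \<le> L * dist x y"
    and limpt: "\<And>x. x \<in> S \<Longrightarrow> x islimpt S"
    and "compact (closure S)" "S \<noteq> {}" "\<And>n. \<rho> n > 0" "L > 0"
  shows "\<exists>\<delta>. (\<forall>n. \<delta> n > 0) \<and> (\<forall>\<pi>\<in>P. \<exists>T\<subseteq>closure S. T \<noteq> {} \<and> (\<forall>k\<in>T. k islimpt T) \<and>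
    (\<forall>k\<in>T. \<forall>n. away_from_multiples (\<delta> n) (\<rho> n) (\<phi> \<pi> n k)))"
proof -
  define Q where "Q r n \<delta> \<longleftrightarrow> (\<forall>x\<in>S. \<forall>z. \<forall>\<pi>\<in>P.
      \<exists>y\<in>S \<inter> ball x r. away_from_multiples \<delta> (\<rho> n) (\<phi> \<pi> n y) \<and> \<delta> \<le> dist y z)" for r n \<delta>
  have "\<exists>\<delta>>0. Q r n \<delta>" if "r > 0" for r n
  proof -
    have 1: "\<exists>a\<in>S \<inter> ball x s. \<exists>b\<in>S \<inter> ball x s. \<exists>\<mu>>0. \<forall>f\<in>(\<lambda>\<pi>. \<phi> \<pi> n) ` P. \<mu> \<le> \<bar>f a - f b\<bar>"
      if "x \<in> S" "s > 0" for x s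
      using pairs[OF that, of n] by simp
    have 2: "\<bar>f x - f y\<bar> \<le> L * dist x y"
      if "f \<in> (\<lambda>\<pi>. \<phi> \<pi> n) ` P" "x \<in> S" "y \<in> S" for f x y
      using that lip closure_subset[of S] by blast
    show ?thesis
      using avoid_uniformly[OF 1 2 limpt assms(4) that assms(6,7)] unfolding Q_def by simp
  qed
  then obtain D where DQ: "\<And>r n. r > 0 \<Longrightarrow> D r n > 0 \<and> Q r n (D r n)" by metis
  have D: "\<forall>r n. r > 0 \<longrightarrow> D r n > 0 \<and> (\<forall>x\<in>S. \<forall>z. \<forall>\<pi>\<in>P.
      \<exists>y\<in>S \<inter> ball x r. away_from_multiples (D r n) (\<rho> n) (\<phi> \<pi> n y) \<and> D r n \<le> dist y z)"
    using DQ unfolding Q_def by blast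
  \<comment> \<open>The margin \<open>\<delta> n\<close> is obtained for radius
    \<open>r n / 2\<close> and then determines \<open>r (Suc n)\<close>. Halving keeps the next ball
    inside the current one; the factor \<open>2 * (L + 1)\<close> makes both a move by
    \<open>r (Suc n)\<close> and the resulting change of a functional at most
    \<open>\<delta> n / 2\<close>.\<close>
  define r where "r = rec_nat 1 (\<lambda>n s. min (s / 2) (D (s / 2) n / (2 * (L + 1))))"
  define \<delta> where "\<delta> n = D (r n / 2) n" for n
  have r_Suc: "r (Suc n) = min (r n / 2) (\<delta> n / (2 * (L + 1)))" for n
    unfolding r_def \<delta>_def by simp
  have r_pos: "r n > 0" for n
  proof (induction n)
    case 0
    show ?case by (simp add: r_def)
  next
    case (Suc n)
    then show ?case using D \<open>L > 0\<close> unfolding r_Suc \<delta>_def by simp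
  qed
  have \<delta>_pos: "\<delta> n > 0" for n using D r_pos[of n] unfolding \<delta>_def by simp
  have r_half: "r (Suc n) \<le> r n / 2" for n unfolding r_Suc by (rule min.cobounded1)
  have "r (Suc n) \<le> \<delta> n / (2 * (L + 1))" for n unfolding r_Suc by (rule min.cobounded2)
  then have r_sum: "L * r (Suc n) + r (Suc n) \<le> \<delta> n / 2" for n
    using \<open>L > 0\<close> by (simp add: field_simps)
  have r_\<delta>: "r (Suc n) \<le> \<delta> n / 2" "L * r (Suc n) \<le> \<delta> n / 2" for n
  proof -
    have "L * r (Suc n) > 0" using \<open>L > 0\<close> r_pos by simp
    then show "r (Suc n) \<le> \<delta> n / 2" "L * r (Suc n) \<le> \<delta> n / 2"
      using r_sum[of n] r_pos[of "Suc n"] by linarith+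
  qed
  have r_le: "r n \<le> (1 / 2) ^ n" for n
  proof (induction n)
    case 0
    show ?case by (simp add: r_def)
  next
    case (Suc n)
    then show ?case using r_half[of n] by simp
  qed
  have r_small: "\<exists>N. \<forall>n\<ge>N. r n < e" if "e > 0" for e
  proof -
    have "(\<lambda>n. (1 / 2 :: real) ^ n) \<longlonglongrightarrow> 0" by (intro LIMSEQ_realpow_zero) auto
    then have "\<forall>\<^sub>F n in sequentially. (1 / 2) ^ n < e" using that by (rule order_tendstoD)
    then show ?thesis unfolding eventually_sequentially using r_le by (meson le_less_trans)
  qed

  text \<open>\<open>W \<pi> N\<close>: centres whose \<open>r N\<close>-ball has already passed stages \<open>0, \<dots>, N - 1\<close>. A point is in
    \<open>T \<pi>\<close> if it lies in such balls for infinitely many \<open>N\<close>.\<close>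
  define W where "W \<pi> N = {x \<in> S. \<forall>k\<in>closure S. dist k x \<le> r N \<longrightarrow>
      (\<forall>n<N. away_from_multiples (\<delta> n / 2) (\<rho> n) (\<phi> \<pi> n k))}" for \<pi> N
  define T where "T \<pi> = {k \<in> closure S. \<forall>M. \<exists>N\<ge>M. \<exists>x\<in>W \<pi> N. dist k x \<le> r N}" for \<pi>

  have step: "\<exists>y\<in>W \<pi> (Suc N). dist x y \<le> r N / 2 \<and> \<delta> N \<le> dist y z"
    if \<pi>: "\<pi> \<in> P" and x: "x \<in> W \<pi> N" for \<pi> x N z
  proof -
    have "x \<in> S" using x unfolding W_def by simp
    then obtain y where y: "y \<in> S" "dist x y < r N / 2"
      "away_from_multiples (\<delta> N) (\<rho> N) (\<phi> \<pi> N y)" "\<delta> N \<le> dist y z"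
      using D[rule_format, of "r N / 2" N] r_pos[of N] \<pi> unfolding \<delta>_def
      by (metis IntE half_gt_zero mem_ball)
    \<comment> \<open>Stage \<open>N\<close> holds with the full margin \<open>\<delta> N\<close> at
      the new centre and loses at most half of it on the new ball. Earlier stages are inherited
      because the new ball lies in the old one.\<close>
    have "away_from_multiples (\<delta> n / 2) (\<rho> n) (\<phi> \<pi> n k)"
      if k: "k \<in> closure S" "dist k y \<le> r (Suc N)" and "n < Suc N" for k n
    proof (cases "n = N")
      case True
      have "\<bar>\<phi> \<pi> N k - \<phi> \<pi> N y\<bar> \<le> L * dist k y"
        using lip \<pi> k y closure_subset by blast
      also have "\<dots> \<le> L * r (Suc N)" using k \<open>L > 0\<close> by simp
      also have "\<dots> \<le> \<delta> N / 2" by (rule r_\<delta>)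
      finally show ?thesis using away_from_multiples_perturb[OF y(3)] True by blast
    next
      case False
      then have "n < N" using \<open>n < Suc N\<close> by simp
      moreover have "dist k x \<le> r N"
        using dist_triangle[of k x y] k y r_half[of N] by (simp add: dist_commute)
      ultimately show ?thesis using x k unfolding W_def by blast
    qed
    then have "y \<in> W \<pi> (Suc N)" using y unfolding W_def by blast
    with y show ?thesis by (intro bexI[of _ y]) auto
  qed

  \<comment> \<open>Iterating \<open>step\<close> gives a Cauchy sequence of centres. The first new
    centre \<open>y\<close> is at least \<open>\<delta> N\<close> away from \<open>z\<close>, while
    the limit is within \<open>r (Suc N)\<close>, hence within \<open>\<delta> N / 2\<close>, of
    \<open>y\<close>; so the limit differs from \<open>z\<close>.\<close>
  have descend: "\<exists>k\<in>T \<pi>. dist k x \<le> r N \<and> k \<noteq> z"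
    if \<pi>: "\<pi> \<in> P" and x: "x \<in> W \<pi> N" for \<pi> x N z
  proof -
    obtain y where y: "y \<in> W \<pi> (Suc N)" "dist x y \<le> r N / 2" "\<delta> N \<le> dist y z"
      using step[OF \<pi> x] by blast
    define M where "M = Suc N"
    have "\<exists>c. \<forall>n. (c n \<in> W \<pi> (M + n) \<and> (n = 0 \<longrightarrow> c n = y)) \<and> dist (c n) (c (Suc n)) \<le> r (M + n) / 2"
    proof (rule dependent_nat_choice)
      show "\<exists>w. w \<in> W \<pi> (M + 0) \<and> (0 = (0::nat) \<longrightarrow> w = y)" using y by (simp add: M_def)
      show "\<exists>w. (w \<in> W \<pi> (M + Suc n) \<and> (Suc n = 0 \<longrightarrow> w = y)) \<and> dist v w \<le> r (M + n) / 2"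
        if "v \<in> W \<pi> (M + n) \<and> (n = 0 \<longrightarrow> v = y)" for v n
        using step[OF \<pi>, of v "M + n" z] that by auto
    qed
    then obtain c where c: "\<And>n. c n \<in> W \<pi> (M + n)" "c 0 = y"
      "\<And>n. dist (c n) (c (Suc n)) \<le> r (M + n) / 2" by blast
    \<comment> \<open>The current radius is added to make the induction work: a move uses at most
      half of it and the next radius is at most the other half, so the left side never increases
      with \<open>j\<close>.\<close>
    have "dist (c n) (c (n + j)) + r (M + n + j) \<le> r (M + n)" for n j
    proof (induction j)
      case 0
      show ?case by simp
    next
      case (Suc j)
      then show ?case
        using dist_triangle[of "c n" "c (n + Suc j)" "c (n + j)"] c(3)[of "n + j"]
          r_half[of "M + n + j"] by (simp add: add.assoc)
    qed
    then have "dist (c n) (c (n + j)) \<le> r (M + n)" for n j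
      using r_pos[of "M + n + j"] by (smt (verit))
    then have c_dist: "dist (c n) (c m) \<le> r (M + n)" if "m \<ge> n" for n m
      using that by (metis le_Suc_ex)
    have c_S: "c n \<in> closure S" for n
      using c(1)[of n] closure_subset unfolding W_def by auto
    have "Cauchy c"
      unfolding Cauchy_altdef
    proof (intro allI impI)
      fix e :: real assume "e > 0"
      then obtain N' where N': "\<forall>n\<ge>N'. r n < e" using r_small by blast
      have "dist (c m) (c n) < e" if "m \<ge> N'" "n > m" for m n
      proof -
        have "r (M + m) < e" using N' that by simp
        then show ?thesis using c_dist[of m n] that by simp
      qed
      then show "\<exists>N'. \<forall>m\<ge>N'. \<forall>n>m. dist (c m) (c n) < e" by blast
    qed
    then obtain k where k: "k \<in> closure S" "c \<longlonglongrightarrow> k"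
      using compact_imp_complete[OF \<open>compact (closure S)\<close>] c_S unfolding complete_def by blast
    have k_dist: "dist k (c n) \<le> r (M + n)" for n
    proof (rule LIMSEQ_le_const2)
      show "(\<lambda>m. dist (c m) (c n)) \<longlonglongrightarrow> dist k (c n)" by (intro tendsto_intros k(2))
      show "\<exists>N'. \<forall>m\<ge>N'. dist (c m) (c n) \<le> r (M + n)"
        using c_dist[of n] by (auto simp: dist_commute)
    qed
    have "\<exists>N'\<ge>n. \<exists>x\<in>W \<pi> N'. dist k x \<le> r N'" for n
      using c(1)[of n] k_dist[of n] by (intro exI[of _ "M + n"]) auto
    then have "k \<in> T \<pi>" using k unfolding T_def by blast
    moreover have "dist k x \<le> r N"
      using dist_triangle[of k x y] k_dist[of 0] y(2) r_half[of N]
      unfolding c(2) M_def by (simp add: dist_commute)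
    moreover have "k \<noteq> z"
    proof
      assume "k = z"
      then show False
        using k_dist[of 0] y(3) r_\<delta>(1)[of N] \<delta>_pos[of N] unfolding c(2) M_def
        by (simp add: dist_commute)
    qed
    ultimately show ?thesis by blast
  qed

  have "T \<pi> \<noteq> {}" if "\<pi> \<in> P" for \<pi>
  proof -
    obtain x where "x \<in> S" using \<open>S \<noteq> {}\<close> by blast
    then have "x \<in> W \<pi> 0" unfolding W_def by simp
    then show ?thesis using descend[OF that] by blast
  qed
  \<comment> \<open>Descending from a centre close to \<open>k\<close>, with \<open>k\<close> itself
    as the point to avoid, gives another point of \<open>T \<pi>\<close> nearby.\<close>
  moreover have "k islimpt T \<pi>" if "\<pi> \<in> P" "k \<in> T \<pi>" for \<pi> k
    unfolding islimpt_approachable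
  proof (intro allI impI)
    fix e :: real assume "e > 0"
    then obtain M where M: "\<forall>n\<ge>M. r n < e / 2" using r_small[of "e / 2"] by auto
    obtain N x where N: "N \<ge> M" "x \<in> W \<pi> N" "dist k x \<le> r N"
      using \<open>k \<in> T \<pi>\<close> unfolding T_def by blast
    obtain k' where k': "k' \<in> T \<pi>" "dist k' x \<le> r N" "k' \<noteq> k"
      using descend[OF \<open>\<pi> \<in> P\<close> N(2)] by blast
    have "dist k' k < e" using dist_triangle2[of k' k x] N k' M by fastforce
    then show "\<exists>k'\<in>T \<pi>. k' \<noteq> k \<and> dist k' k < e" using k' by blast
  qed
  moreover have "away_from_multiples (\<delta> n / 2) (\<rho> n) (\<phi> \<pi> n k)" if "k \<in> T \<pi>" for \<pi> k n
  proof -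
    have "\<exists>N\<ge>Suc n. \<exists>x\<in>W \<pi> N. dist k x \<le> r N" and k: "k \<in> closure S"
      using that unfolding T_def by blast+
    then obtain N x where "n < N" "x \<in> W \<pi> N" "dist k x \<le> r N" by (auto simp: Suc_le_eq)
    with k show ?thesis unfolding W_def by auto
  qed
  moreover have "T \<pi> \<subseteq> closure S" for \<pi> unfolding T_def by blast
  ultimately have "\<forall>\<pi>\<in>P. \<exists>T\<subseteq>closure S. T \<noteq> {} \<and> (\<forall>k\<in>T. k islimpt T) \<and>
    (\<forall>k\<in>T. \<forall>n. away_from_multiples (\<delta> n / 2) (\<rho> n) (\<phi> \<pi> n k))"
    by (intro ballI exI[of _ "T _"] conjI allI)
  then show ?thesis using \<delta>_pos by (intro exI[of _ "\<lambda>n. \<delta> n / 2"]) simp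
qed

section \<open>Pairs of a single colour\<close>

text \<open>Otherwise the colours could be eliminated one at a time by shrinking the open set while
  it still meets \<open>K\<close>. After finitely many steps no colour would be left for two
  distinct points, which exist because \<open>K\<close> has no isolated points.\<close>

lemma exists_everywhere_dense_colour:
  fixes K :: "'a::metric_space set" and C :: "'k::finite \<Rightarrow> 'a \<Rightarrow> 'a \<Rightarrow> bool"
  assumes limpt: "\<And>x. x \<in> K \<Longrightarrow> x islimpt K"
    and U: "open U" "K \<inter> U \<noteq> {}"
    and colour: "\<And>a b. a \<noteq> b \<Longrightarrow> \<exists>k. C k a b"
  obtains k V where "open V" "V \<subseteq> U" "K \<inter> V \<noteq> {}"
    "\<And>x r. x \<in> K \<inter> V \<Longrightarrow> r > 0 \<Longrightarrow>
      \<exists>a\<in>K \<inter> V \<inter> ball x r. \<exists>b\<in>K \<inter> V \<inter> ball x r. a \<noteq> b \<and> C k a b"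
proof -
  define free where "free k W \<longleftrightarrow> (\<forall>a\<in>K \<inter> W. \<forall>b\<in>K \<inter> W. a \<noteq> b \<longrightarrow> \<not> C k a b)" for k W
  have free_mono: "free k W'" if "free k W" "W' \<subseteq> W" for k W W'
    using that unfolding free_def by blast
  have "\<exists>k V. open V \<and> V \<subseteq> U \<and> K \<inter> V \<noteq> {} \<and> (\<forall>x\<in>K \<inter> V. \<forall>r>0. \<not> free k (V \<inter> ball x r))"
  proof (rule ccontr)
    assume no: "\<not> ?thesis"
    have "\<exists>V. open V \<and> V \<subseteq> U \<and> K \<inter> V \<noteq> {} \<and> (\<forall>k\<in>F. free k V)" if "finite F" for F
      using that
    proof induction
      case empty
      show ?case using U by auto
    next
      case (insert k F)
      then obtain V where V: "open V" "V \<subseteq> U" "K \<inter> V \<noteq> {}" "\<forall>k\<in>F. free k V"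
        by (elim exE conjE)
      with no obtain x r where x: "x \<in> K \<inter> V" "r > 0" "free k (V \<inter> ball x r)"
        by metis
      have "open (V \<inter> ball x r)" using V by auto
      moreover have "V \<inter> ball x r \<subseteq> U" using V by auto
      moreover have "K \<inter> (V \<inter> ball x r) \<noteq> {}" using x by auto
      moreover have "\<forall>k'\<in>insert k F. free k' (V \<inter> ball x r)"
        using x V free_mono by auto
      ultimately show ?case by (intro exI conjI)
    qed
    from this[OF finite[of UNIV]] obtain V where V: "open V" "K \<inter> V \<noteq> {}" and none: "\<And>k. free k V"
      by (metis UNIV_I)
    then obtain x where x: "x \<in> K \<inter> V" by blast
    then obtain y where "y \<in> K \<inter> V" "y \<noteq> x"
      using limpt[of x] V(1) unfolding islimpt_def by (metis Int_iff)
    with x colour none show False unfolding free_def by metis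
  qed
  then obtain k V where V: "open V" "V \<subseteq> U" "K \<inter> V \<noteq> {}"
    "\<And>x r. x \<in> K \<inter> V \<Longrightarrow> r > 0 \<Longrightarrow> \<not> free k (V \<inter> ball x r)" by metis
  show thesis
    by (rule that[OF V(1-3), of k]) (use V(4) in \<open>simp add: free_def Int_assoc\<close>)
qed

section \<open>The slanted coordinate functionals\<close>

text \<open>The coefficient 2 prevents cancellation: if coordinate \<open>k\<close> dominates, the
  value is at least its size for every \<open>i\<close>. The case \<open>i = k\<close> gives three
  times that coordinate, from which the others are recovered.\<close>

definition slant :: "'n \<Rightarrow> 'n \<Rightarrow> real ^ 'n \<Rightarrow> real" where
  "slant k i x = 2 * x $ k + x $ i"

lemma slant_diff: "slant k i (x - y) = slant k i x - slant k i y"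
  by (simp add: slant_def)

lemma abs_slant_le: "\<bar>slant k i x\<bar> \<le> 3 * norm x"
  using component_le_norm_cart[of x k] component_le_norm_cart[of x i] unfolding slant_def by linarith

lemma abs_slant_ge: "\<bar>x $ i\<bar> \<le> \<bar>x $ k\<bar> \<Longrightarrow> \<bar>x $ k\<bar> \<le> \<bar>slant k i x\<bar>"
  unfolding slant_def by linarith

lemma slant_eqI:
  assumes "\<And>i. slant k i x = slant k i y"
  shows "x = y"
proof -
  have "x $ k = y $ k" using assms[of k] by (simp add: slant_def)
  then show ?thesis using assms by (simp add: slant_def vec_eq_iff)
qed

lemma continuous_on_slant: "continuous_on A (slant k i)"
  unfolding slant_def by (intro continuous_intros)

lemma exists_dominant_component:
  fixes v :: "real ^ 'n"
  shows "\<exists>k. \<forall>j. \<bar>v $ j\<bar> \<le> \<bar>v $ k\<bar>"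
proof -
  have "Max (range (\<lambda>j. \<bar>v $ j\<bar>)) \<in> range (\<lambda>j. \<bar>v $ j\<bar>)" by (rule Max_in) auto
  then obtain k where "Max (range (\<lambda>j. \<bar>v $ j\<bar>)) = \<bar>v $ k\<bar>" by (rule imageE)
  then have "\<forall>j. \<bar>v $ j\<bar> \<le> \<bar>v $ k\<bar>" by (metis Max_ge finite finite_imageI rangeI)
  then show ?thesis ..
qed

lemma norm_le_dominant_component:
  fixes v :: "real ^ 'n"
  assumes "\<And>j. \<bar>v $ j\<bar> \<le> \<bar>v $ k\<bar>"
  shows "norm v \<le> CARD('n) * \<bar>v $ k\<bar>"
proof -
  have "norm v \<le> (\<Sum>j\<in>UNIV. \<bar>v $ j\<bar>)" by (rule norm_le_l1_cart)
  also have "\<dots> \<le> CARD('n) * \<bar>v $ k\<bar>" using sum_bounded_above[of UNIV "\<lambda>j. \<bar>v $ j\<bar>"] assms by simp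
  finally show ?thesis .
qed

section \<open>Neighbourhoods in the C1 metric\<close>

lemma C1_maps_has_derivative:
  "g \<in> C1_maps \<Longrightarrow> (g has_derivative (*v) (jacobian g (at x))) (at x)"
  unfolding C1_maps_def by (simp flip: jacobian_works)

lemma jacobian_diff:
  assumes "f \<in> C1_maps" "g \<in> C1_maps"
  shows "jacobian (\<lambda>x. f x - g x) (at x) = jacobian f (at x) - jacobian g (at x)"
proof -
  have "((\<lambda>x. f x - g x) has_derivative (\<lambda>h. jacobian f (at x) *v h - jacobian g (at x) *v h)) (at x)"
    by (intro has_derivative_diff C1_maps_has_derivative assms)
  then have "((\<lambda>x. f x - g x) has_derivative (*v) (jacobian f (at x) - jacobian g (at x))) (at x)"
    by (simp only: matrix_vector_mult_diff_rdistrib[symmetric])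
  then have "frechet_derivative (\<lambda>x. f x - g x) (at x) = (*v) (jacobian f (at x) - jacobian g (at x))"
    by (rule frechet_derivative_at[symmetric])
  then show ?thesis unfolding jacobian_def by simp
qed

lemma C1_maps_diff:
  assumes "f \<in> C1_maps" "g \<in> C1_maps"
  shows "(\<lambda>x. f x - g x) \<in> C1_maps"
proof -
  have "continuous_on UNIV (\<lambda>x. jacobian f (at x) - jacobian g (at x))"
    using assms unfolding C1_maps_def by (intro continuous_intros) auto
  then show ?thesis
    using assms unfolding C1_maps_def by (auto simp: jacobian_diff[OF assms, unfolded C1_maps_def])
qed

text \<open>Continuity on the compact set bounds the families under the suprema, so these dominate
  the pointwise values. Each of the two summands of the norm is nonnegative, and a single entry is
  at most the Euclidean norm of all entries.\<close>

lemma C1_norm_bounds: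
  fixes f :: "real ^ 'n \<Rightarrow> real ^ 'n"
  assumes f: "f \<in> C1_maps" and R: "compact (R n)" "x \<in> R n"
  shows "norm (f x) \<le> C1_norm R n f" "\<bar>jacobian f (at x) $ j $ i\<bar> \<le> C1_norm R n f"
proof -
  define A where "A = (SUP x\<in>R n. norm (f x))"
  define B where "B i j = (SUP x\<in>R n. \<bar>jacobian f (at x) $ j $ i\<bar>)" for i j
  have "continuous_on (R n) f"
    using f unfolding C1_maps_def
    by (auto intro!: continuous_at_imp_continuous_on differentiable_imp_continuous_within)
  then have "bdd_above ((\<lambda>x. norm (f x)) ` R n)"
    by (intro bounded_imp_bdd_above compact_imp_bounded compact_continuous_image R continuous_intros)
  then have A: "norm (f x) \<le> A" unfolding A_def using R by (intro cSUP_upper)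
  have "continuous_on (R n) (\<lambda>x. jacobian f (at x))"
    using f unfolding C1_maps_def by (auto intro: continuous_on_subset)
  then have "bdd_above ((\<lambda>x. \<bar>jacobian f (at x) $ j $ i\<bar>) ` R n)" for i j
    by (intro bounded_imp_bdd_above compact_imp_bounded compact_continuous_image R continuous_intros)
  then have B: "\<bar>jacobian f (at x) $ j $ i\<bar> \<le> B i j" for i j
    unfolding B_def using R by (intro cSUP_upper)
  have norm_eq: "C1_norm R n f = A + sqrt (\<Sum>i\<in>UNIV. \<Sum>j\<in>UNIV. (B i j)\<^sup>2)"
    unfolding C1_norm_def A_def B_def ..
  have "(B i j)\<^sup>2 \<le> (\<Sum>j\<in>UNIV. (B i j)\<^sup>2)" by (rule member_le_sum) auto
  also have "\<dots> \<le> (\<Sum>i\<in>UNIV. \<Sum>j\<in>UNIV. (B i j)\<^sup>2)"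
    by (rule member_le_sum[where f = "\<lambda>i. \<Sum>j\<in>UNIV. (B i j)\<^sup>2"]) (auto intro: sum_nonneg)
  finally have "B i j \<le> sqrt (\<Sum>i\<in>UNIV. \<Sum>j\<in>UNIV. (B i j)\<^sup>2)" by (rule real_le_rsqrt)
  moreover have "0 \<le> A" using A norm_ge_zero by (rule order_trans[rotated])
  moreover have "0 \<le> sqrt (\<Sum>i\<in>UNIV. \<Sum>j\<in>UNIV. (B i j)\<^sup>2)" by (intro real_sqrt_ge_zero sum_nonneg) auto
  ultimately show "norm (f x) \<le> C1_norm R n f" "\<bar>jacobian f (at x) $ j $ i\<bar> \<le> C1_norm R n f"
    using A B[where i = i and j = j] unfolding norm_eq by linarith+
qed

text \<open>A single term of a convergent series of nonnegative terms is at most its sum, and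
  t/(1+t) is strictly increasing for nonnegative t. Term \<open>n\<close> belongs to
  \<open>R (Suc n)\<close>.\<close>

lemma C1_norm_less_of_C1_dist_less:
  fixes f g :: "real ^ 'n \<Rightarrow> real ^ 'n"
  assumes R: "compact_exhaustion R" and "f \<in> C1_maps" "g \<in> C1_maps" "e > 0"
    and dist: "C1_dist R f g < 1 / 2 ^ Suc n * (e / (1 + e))"
  shows "C1_norm R (Suc n) (\<lambda>x. f x - g x) < e"
proof -
  define s where "s m = C1_norm R (Suc m) (\<lambda>x. f x - g x)" for m
  define a where "a m = 1 / 2 ^ Suc m * (s m / (1 + s m))" for m
  have s: "0 \<le> s m" for m
  proof -
    have "compact (R (Suc m))" "R (Suc m) \<noteq> {}" using R unfolding compact_exhaustion_def by auto
    then show ?thesis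
      using C1_norm_bounds(1)[OF C1_maps_diff[OF assms(2,3)]] norm_ge_zero order_trans
      unfolding s_def by (metis ex_in_conv)
  qed
  have a0: "0 \<le> a m" for m using s[of m] unfolding a_def by simp
  have "norm (a m) \<le> (1 / 2) ^ Suc m" for m
  proof -
    have "s m / (1 + s m) \<le> 1" using s[of m] by simp
    then have "a m \<le> 1 / 2 ^ Suc m * 1" unfolding a_def by (intro mult_left_mono) auto
    then show ?thesis using a0[of m] by (simp add: power_one_over)
  qed
  moreover have "summable (\<lambda>m. (1 / 2 :: real) ^ Suc m)"
    unfolding summable_Suc_iff by (intro summable_geometric) simp
  ultimately have "summable a"
    using summable_comparison_test'[of "\<lambda>m. (1 / 2) ^ Suc m" 0 a] by blast
  then have "a n \<le> suminf a" using sum_le_suminf[of a "{n}"] a0 by simp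
  also have "suminf a = C1_dist R f g" unfolding C1_dist_def a_def s_def ..
  finally have "1 / 2 ^ Suc n * (s n / (1 + s n)) < 1 / 2 ^ Suc n * (e / (1 + e))"
    using dist unfolding a_def by linarith
  then have "s n / (1 + s n) < e / (1 + e)" 
    by (subst (asm) mult_less_cancel_left_pos) auto
  then have "s n < e" using s[of n] \<open>e > 0\<close> by (simp add: field_simps)
  then show ?thesis unfolding s_def .
qed

text \<open>Near \<open>p\<close> the Jacobian of every \<open>g\<close> in a small ball is close to
  that of \<open>g0\<close> at \<open>p\<close>. The mean value inequality for \<open>g\<close>
  minus this fixed linear map turns this into the estimate on differences.\<close>

lemma C1_ball_uniformly_almost_linear:
  fixes g0 :: "real ^ 'n \<Rightarrow> real ^ 'n"
  assumes R: "compact_exhaustion R" and g0: "g0 \<in> C1_maps" and "\<eta> > 0"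
  shows "\<exists>\<epsilon>>0. \<exists>s>0. \<forall>g\<in>C1_ball R g0 \<epsilon>. norm (g p) \<le> norm (g0 p) + 1 \<and>
    (\<forall>a\<in>ball p s. \<forall>b\<in>ball p s.
      norm (g a - g b - jacobian g0 (at p) *v (a - b)) \<le> \<eta> * norm (a - b))"
proof -
  define A where "A = jacobian g0 (at p)"
  define d where "d = real CARD('n)"
  have "d > 0" unfolding d_def by simp
  \<comment> \<open>One \<open>e\<close> accounts for the passage from \<open>g\<close> to
    \<open>g0\<close>, another for the continuity of the Jacobian of \<open>g0\<close>. Entries
    bounded by \<open>2 * e\<close> give operator norm at most \<open>d * d * (2 * e)\<close>; the
    bound 1 serves the value at \<open>p\<close>.\<close>
  define e where "e = min 1 (\<eta> / (2 * d * d))"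
  have e: "e > 0" "e \<le> 1" using \<open>\<eta> > 0\<close> \<open>d > 0\<close> unfolding e_def by auto
  have "e \<le> \<eta> / (2 * d * d)" unfolding e_def by simp
  then have e_eta: "d * d * (2 * e) \<le> \<eta>" using \<open>d > 0\<close> by (simp add: field_simps)
  obtain n where "p \<in> R n" "n \<ge> 1" using R unfolding compact_exhaustion_def by blast
  then have "p \<in> interior (R (Suc n))" using R unfolding compact_exhaustion_def by blast
  then obtain s1 where s1: "s1 > 0" "ball p s1 \<subseteq> R (Suc n)" using mem_interior by blast
  have comp: "compact (R (Suc n))" using R unfolding compact_exhaustion_def by simp
  have "isCont (\<lambda>x. jacobian g0 (at x)) p"
    using g0 unfolding C1_maps_def by (auto simp: continuous_on_eq_continuous_at)
  then obtain s2 where s2: "s2 > 0" "\<And>x. dist x p < s2 \<Longrightarrow> dist (jacobian g0 (at x)) A < e"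
    using e(1) unfolding continuous_at_eps_delta A_def by blast
  define s where "s = min s1 s2"
  have "s > 0" using s1 s2 unfolding s_def by simp
  define \<epsilon> where "\<epsilon> = 1 / 2 ^ Suc n * (e / (1 + e))"
  have "\<epsilon> > 0" using e unfolding \<epsilon>_def by simp
  moreover have "norm (g p) \<le> norm (g0 p) + 1 \<and>
      (\<forall>a\<in>ball p s. \<forall>b\<in>ball p s. norm (g a - g b - A *v (a - b)) \<le> \<eta> * norm (a - b))"
    if "g \<in> C1_ball R g0 \<epsilon>" for g
  proof
    have g: "g \<in> C1_maps" "C1_dist R g0 g < \<epsilon>" using that unfolding C1_ball_def by auto
    note diff = C1_maps_diff[OF g0 g(1)]
    have small: "C1_norm R (Suc n) (\<lambda>x. g0 x - g x) < e"
      using C1_norm_less_of_C1_dist_less[OF R g0 g(1) e(1)] g(2) unfolding \<epsilon>_def by blast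
    have "p \<in> R (Suc n)" using s1 by auto
    from C1_norm_bounds(1)[where f = "\<lambda>x. g0 x - g x" and R = R and n = "Suc n", OF diff comp this] have "norm (g0 p - g p) \<le> 1"
      using small e(2) by linarith
    then show "norm (g p) \<le> norm (g0 p) + 1" using norm_triangle_ineq2[of "g p" "g0 p"]
      by (simp add: norm_minus_commute)
    have onorm: "onorm ((*v) (jacobian g (at x) - A)) \<le> \<eta>" if x: "x \<in> ball p s" for x
    proof -
      have "\<bar>(jacobian g (at x) - A) $ j $ i\<bar> \<le> 2 * e" for i j
      proof -
        have "x \<in> R (Suc n)" using x s1 unfolding s_def by auto
        then have "\<bar>jacobian g0 (at x) $ j $ i - jacobian g (at x) $ j $ i\<bar> \<le> e"
          using C1_norm_bounds(2)[where f = "\<lambda>x. g0 x - g x" and R = R and n = "Suc n", OF diff comp, of x j i] small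
          by (simp add: jacobian_diff[OF g0 g(1)])
        moreover have "norm (jacobian g0 (at x) - A) < e"
          using s2(2)[of x] x unfolding s_def by (simp add: dist_norm norm_minus_commute)
        then have "\<bar>(jacobian g0 (at x) - A) $ j $ i\<bar> \<le> e"
          using component_le_norm_cart[of "(jacobian g0 (at x) - A) $ j" i]
            Finite_Cartesian_Product.norm_nth_le[of "jacobian g0 (at x) - A" j] by linarith
        ultimately show ?thesis by simp
      qed
      then have "onorm ((*v) (jacobian g (at x) - A)) \<le> d * d * (2 * e)"
        unfolding d_def by (rule onorm_le_matrix_component)
      then show ?thesis using e_eta by linarith
    qed
    show "\<forall>a\<in>ball p s. \<forall>b\<in>ball p s. norm (g a - g b - A *v (a - b)) \<le> \<eta> * norm (a - b)"
    proof (intro ballI)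
      fix a b assume ab: "a \<in> ball p s" "b \<in> ball p s"
      have "norm ((g a - A *v a) - (g b - A *v b)) \<le> \<eta> * norm (a - b)"
      proof (rule differentiable_bound[OF convex_ball _ onorm ab])
        fix x
        have "((\<lambda>x. g x - A *v x) has_derivative (\<lambda>h. jacobian g (at x) *v h - A *v h)) (at x)"
          by (intro has_derivative_diff C1_maps_has_derivative g bounded_linear_imp_has_derivative
              matrix_vector_mul_bounded_linear)
        then show "((\<lambda>x. g x - A *v x) has_derivative (*v) (jacobian g (at x) - A))
            (at x within ball p s)"
          by (simp only: matrix_vector_mult_diff_rdistrib[symmetric] has_derivative_at_withinI)
      qed
      then show "norm (g a - g b - A *v (a - b)) \<le> \<eta> * norm (a - b)"
        by (simp add: matrix_vector_mult_diff_distrib algebra_simps)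
    qed
  qed
  ultimately show ?thesis using \<open>s > 0\<close> unfolding A_def by blast
qed

section \<open>Construction of the second Cantor set\<close>

text \<open>The parameters of the avoidance construction are pairs of a target \<open>t\<close> and
  a map \<open>g\<close>. Collecting \<open>t - g q\<close> for all surviving \<open>q\<close> gives
  the covering, since t = g q + (t - g q).\<close>

lemma cantor_set_plus_covers_ball:
  fixes K1 :: "(real ^ 'n) set" and J :: "real ^ 'n \<Rightarrow> real ^ 'n"
  assumes K1: "cantor_set K1" and "p \<in> K1"
    and J: "linear J" "c > 0" "\<And>v. c * norm v \<le> norm (J v)"
    and "s > 0" "G \<noteq> {}"
    and approx: "\<And>g a b. g \<in> G \<Longrightarrow> a \<in> ball p s \<Longrightarrow> b \<in> ball p s \<Longrightarrow>
      norm (g a - g b - J (a - b)) \<le> c / (6 * real CARD('n)) * norm (a - b)"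
    and bounded_at_p: "\<And>g. g \<in> G \<Longrightarrow> norm (g p) \<le> M"
  shows "\<exists>K2. cantor_set K2 \<and> ball 0 1 \<subseteq> (\<Inter>g\<in>G. g ` K1 + K2)"
proof -
  define d where "d = real CARD('n)"
  have "d \<ge> 1" unfolding d_def by (simp add: Suc_leI)
  \<comment> \<open>The dominant coordinate of \<open>J (a - b)\<close> is at least
    \<open>c * norm (a - b) / d\<close>. A slanted functional magnifies the error by at most 3, so
    with this \<open>\<eta>\<close> at most half of that coordinate is lost.\<close>
  define \<eta> where "\<eta> = c / (6 * d)"
  have "\<eta> > 0" using \<open>c > 0\<close> \<open>d \<ge> 1\<close> unfolding \<eta>_def by simp
  have approx: "norm (g a - g b - J (a - b)) \<le> \<eta> * norm (a - b)"
    if "g \<in> G" "a \<in> ball p s" "b \<in> ball p s" for g a b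
    using approx[OF that] unfolding \<eta>_def d_def .
  have "closed K1" and limpt: "\<And>x. x \<in> K1 \<Longrightarrow> x islimpt K1"
    using K1 unfolding cantor_set_def perfect_set_def by auto

  \<comment> \<open>A single-coloured piece of \<open>K1\<close> near \<open>p\<close>\<close>
  define C where "C k a b \<longleftrightarrow> (\<forall>j. \<bar>J (a - b) $ j\<bar> \<le> \<bar>J (a - b) $ k\<bar>)" for k a b
  \<comment> \<open>Half the radius is used so that even \<open>closure S\<close> stays in the open
    ball where \<open>approx\<close> holds.\<close>
  have "K1 \<inter> ball p (s / 2) \<noteq> {}" using \<open>p \<in> K1\<close> \<open>s > 0\<close> by auto
  moreover have "\<exists>k. C k a b" for a b unfolding C_def by (rule exists_dominant_component)
  ultimately obtain k V where V: "open V" "V \<subseteq> ball p (s / 2)" "K1 \<inter> V \<noteq> {}"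
    and dense: "\<And>x r. x \<in> K1 \<inter> V \<Longrightarrow> r > 0 \<Longrightarrow>
      \<exists>a\<in>K1 \<inter> V \<inter> ball x r. \<exists>b\<in>K1 \<inter> V \<inter> ball x r. a \<noteq> b \<and> C k a b"
    using exists_everywhere_dense_colour[OF limpt open_ball, of p "s / 2" C] by metis
  define S where "S = K1 \<inter> V"
  have "S \<subseteq> ball p s" using V(2) \<open>s > 0\<close> unfolding S_def by (auto simp: subset_iff)
  have "closure S \<subseteq> K1" by (rule closure_minimal) (auto simp: S_def \<open>closed K1\<close>)
  have "closure S \<subseteq> cball p (s / 2)"
    by (rule closure_minimal) (use V(2) in \<open>auto simp: S_def subset_iff\<close>)
  then have cl_S: "closure S \<subseteq> ball p s" using \<open>s > 0\<close> by (auto simp: subset_iff)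
  have "compact (closure S)"
    using \<open>closure S \<subseteq> cball p (s / 2)\<close> by (meson bounded_cball bounded_subset closed_closure compact_eq_bounded_closed)
  have limpt_S: "x islimpt S" if "x \<in> S" for x
    using limpt[of x] that V(1) unfolding S_def islimpt_def by (metis Int_iff open_Int)

  obtain B where B: "B > 0" "\<And>v. norm (J v) \<le> B * norm v"
    using linear_bounded_pos[OF \<open>linear J\<close>] by blast
  have lip_g: "norm (g a - g b) \<le> (B + \<eta>) * norm (a - b)"
    if "g \<in> G" "a \<in> ball p s" "b \<in> ball p s" for g a b
    using approx[OF that] B(2)[of "a - b"] norm_triangle_sub[of "g a - g b" "J (a - b)"]
    by (simp add: algebra_simps)

  \<comment> \<open>Decoding \<open>n\<close> as a pair enumerates all combinations of a coordinate
    and a spacing 1/(m+1), so every functional is met with arbitrarily small spacing.\<close>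
  define i where "i n = (from_nat (fst (prod_decode n)) :: 'n)" for n
  define \<rho> where "\<rho> n = inverse (real (Suc (snd (prod_decode n))))" for n
  have stage: "\<exists>n. i n = j \<and> \<rho> n = inverse (real (Suc m))" for j m
    by (rule exI[of _ "prod_encode (to_nat j, m)"]) (simp add: i_def \<rho>_def)
  \<comment> \<open>This is the stage \<open>n\<close> functional of the candidate point t - g x.
    The translation \<open>t\<close> cancels in differences, so all estimates are uniform in
    it.\<close>
  define \<phi> where "\<phi> \<pi> n x = slant k (i n) (fst \<pi> - snd \<pi> x)"
    for \<pi> :: "(real ^ 'n) \<times> (real ^ 'n \<Rightarrow> real ^ 'n)" and n x
  define P where "P = ball (0 :: real ^ 'n) 1 \<times> G"
  have \<phi>_diff: "\<bar>\<phi> \<pi> n a - \<phi> \<pi> n b\<bar> = \<bar>slant k (i n) (snd \<pi> a - snd \<pi> b)\<bar>" for \<pi> n a b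
    unfolding \<phi>_def slant_diff by simp

  have pairs: "\<exists>a\<in>S \<inter> ball x r. \<exists>b\<in>S \<inter> ball x r. \<exists>\<mu>>0. \<forall>\<pi>\<in>P. \<mu> \<le> \<bar>\<phi> \<pi> n a - \<phi> \<pi> n b\<bar>"
    if "x \<in> S" "r > 0" for n x r
  proof -
    obtain a b where ab: "a \<in> S \<inter> ball x r" "b \<in> S \<inter> ball x r" "a \<noteq> b" "C k a b"
      using dense[of x r] \<open>x \<in> S\<close> \<open>r > 0\<close> unfolding S_def by blast
    define v where "v = J (a - b)"
    have v: "\<bar>v $ j\<bar> \<le> \<bar>v $ k\<bar>" for j using ab(4) unfolding C_def v_def by blast
    have "c * norm (a - b) \<le> norm v" using J(3) unfolding v_def by blast
    also have "\<dots> \<le> d * \<bar>v $ k\<bar>" unfolding d_def by (rule norm_le_dominant_component[OF v])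
    finally have c_ab: "c * norm (a - b) \<le> d * \<bar>v $ k\<bar>" .
    then have "3 * (\<eta> * norm (a - b)) \<le> \<bar>v $ k\<bar> / 2"
      using \<open>d \<ge> 1\<close> unfolding \<eta>_def by (simp add: field_simps)
    then have "\<bar>v $ k\<bar> / 2 \<le> \<bar>\<phi> \<pi> n a - \<phi> \<pi> n b\<bar>" if "\<pi> \<in> P" for \<pi>
    proof -
      have "snd \<pi> \<in> G" using that unfolding P_def by auto
      then have "norm (snd \<pi> a - snd \<pi> b - v) \<le> \<eta> * norm (a - b)"
        using approx[of "snd \<pi>" a b] ab \<open>S \<subseteq> ball p s\<close> unfolding v_def by blast
      then have "\<bar>slant k (i n) (snd \<pi> a - snd \<pi> b - v)\<bar> \<le> \<bar>v $ k\<bar> / 2"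
        using abs_slant_le[of k "i n" "snd \<pi> a - snd \<pi> b - v"]
          \<open>3 * (\<eta> * norm (a - b)) \<le> \<bar>v $ k\<bar> / 2\<close> by linarith
      moreover have "\<bar>v $ k\<bar> \<le> \<bar>slant k (i n) v\<bar>" by (rule abs_slant_ge[OF v])
      ultimately show ?thesis unfolding \<phi>_diff slant_diff[of k _ _ v] by linarith
    qed
    moreover have "\<bar>v $ k\<bar> / 2 > 0"
    proof -
      have "c * norm (a - b) > 0" using \<open>c > 0\<close> ab(3) by simp
      then have "d * \<bar>v $ k\<bar> > 0" using c_ab by linarith
      then show ?thesis using \<open>d \<ge> 1\<close> by (simp add: zero_less_mult_iff)
    qed
    ultimately show ?thesis using ab by blast
  qed
  have lip: "\<bar>\<phi> \<pi> n x - \<phi> \<pi> n y\<bar> \<le> 3 * (B + \<eta>) * dist x y"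
    if "\<pi> \<in> P" "x \<in> closure S" "y \<in> closure S" for \<pi> n x y
  proof -
    have "snd \<pi> \<in> G" using that unfolding P_def by auto
    then have "norm (snd \<pi> x - snd \<pi> y) \<le> (B + \<eta>) * norm (x - y)"
      using lip_g that cl_S by blast
    then show ?thesis
      using abs_slant_le[of k "i n" "snd \<pi> x - snd \<pi> y"] unfolding \<phi>_diff dist_norm by linarith
  qed
  have \<rho>_pos: "\<rho> n > 0" for n unfolding \<rho>_def by simp
  have "S \<noteq> {}" using V(3) unfolding S_def .
  have "3 * (B + \<eta>) > 0" using \<open>B > 0\<close> \<open>\<eta> > 0\<close> by simp
  have "\<exists>\<delta>. (\<forall>n. \<delta> n > 0) \<and> (\<forall>\<pi>\<in>P. \<exists>T\<subseteq>closure S. T \<noteq> {} \<and> (\<forall>k\<in>T. k islimpt T) \<and>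
      (\<forall>k\<in>T. \<forall>n. away_from_multiples (\<delta> n) (\<rho> n) (\<phi> \<pi> n k)))"
    by (rule exists_avoiding_perfect_subset[where L = "3 * (B + \<eta>)"]) fact+
  then obtain \<delta> where \<delta>_pos: "\<forall>n. \<delta> n > 0"
    and "\<forall>\<pi>\<in>P. \<exists>T\<subseteq>closure S. T \<noteq> {} \<and> (\<forall>k\<in>T. k islimpt T) \<and>
      (\<forall>k\<in>T. \<forall>n. away_from_multiples (\<delta> n) (\<rho> n) (\<phi> \<pi> n k))"
    by (elim exE conjE)
  from bchoice[OF this(2)] obtain T where
    "\<forall>\<pi>\<in>P. T \<pi> \<subseteq> closure S \<and> T \<pi> \<noteq> {} \<and> (\<forall>k\<in>T \<pi>. k islimpt T \<pi>) \<and>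
      (\<forall>k\<in>T \<pi>. \<forall>n. away_from_multiples (\<delta> n) (\<rho> n) (\<phi> \<pi> n k))" ..
  then have T: "\<And>\<pi>. \<pi> \<in> P \<Longrightarrow> T \<pi> \<subseteq> closure S"
    "\<And>\<pi>. \<pi> \<in> P \<Longrightarrow> T \<pi> \<noteq> {}" "\<And>\<pi> k. \<pi> \<in> P \<Longrightarrow> k \<in> T \<pi> \<Longrightarrow> k islimpt T \<pi>"
    "\<And>\<pi> k n. \<pi> \<in> P \<Longrightarrow> k \<in> T \<pi> \<Longrightarrow> away_from_multiples (\<delta> n) (\<rho> n) (\<phi> \<pi> n k)"
    by auto

  \<comment> \<open>The closure of the survivors as a Cantor set\<close>
  define U where "U = (\<Union>\<pi>\<in>P. (\<lambda>k. fst \<pi> - snd \<pi> k) ` T \<pi>)"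
  define K2 where "K2 = closure U"
  have U_away: "away_from_multiples (\<delta> n) (\<rho> n) (slant k (i n) x)" if "x \<in> U" for x n
    using that T(4) unfolding U_def \<phi>_def by auto
  have K2_away: "away_from_multiples (\<delta> n) (\<rho> n) (slant k (i n) x)" if "x \<in> K2" for x n
  proof -
    have "closed (slant k (i n) -` {y. away_from_multiples (\<delta> n) (\<rho> n) y})"
      by (intro closed_vimage closed_away_from_multiples continuous_on_slant)
    then have "K2 \<subseteq> slant k (i n) -` {y. away_from_multiples (\<delta> n) (\<rho> n) y}"
      unfolding K2_def using U_away by (intro closure_minimal) auto
    then show ?thesis using that by auto
  qed

  have "compact K2"
  proof -
    \<comment> \<open>The bound is independent of \<open>g\<close>: values at \<open>p\<close> are
      bounded by \<open>M\<close>, and all maps in \<open>G\<close> share the Lipschitz constant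
      \<open>B + \<eta>\<close> on the ball.\<close>
    have "norm x \<le> 1 + (M + (B + \<eta>) * s)" if "x \<in> U" for x
    proof -
      obtain t g q where x: "x = t - g q" "norm t < 1" "g \<in> G" "q \<in> T (t, g)" "(t, g) \<in> P"
        using \<open>x \<in> U\<close> unfolding U_def P_def by auto
      then have q: "q \<in> ball p s" using T(1) cl_S by blast
      have "norm (g q - g p) \<le> (B + \<eta>) * norm (q - p)"
        using lip_g x q \<open>s > 0\<close> by simp
      also have "\<dots> \<le> (B + \<eta>) * s"
        using q \<open>B > 0\<close> \<open>\<eta> > 0\<close> by (intro mult_left_mono) (auto simp: dist_norm norm_minus_commute)
      finally have "norm (g q) \<le> M + (B + \<eta>) * s"
        using bounded_at_p[OF x(3)] norm_triangle_sub[of "g q" "g p"] by linarith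
      then show ?thesis using x(2) norm_triangle_ineq4[of t "g q"] unfolding x(1) by linarith
    qed
    then have "bounded U" unfolding bounded_iff by blast
    then show ?thesis unfolding K2_def by (simp add: compact_closure)
  qed
  moreover have "K2 \<noteq> {}"
  proof -
    obtain g where "g \<in> G" using \<open>G \<noteq> {}\<close> by blast
    then have "(0, g) \<in> P" unfolding P_def by simp
    then show ?thesis using T(2) unfolding K2_def U_def by auto
  qed
  moreover have "perfect_set K2"
    unfolding perfect_set_def
  proof (intro conjI ballI)
    show "closed K2" unfolding K2_def by simp
    have U_limpt: "x islimpt U" if "x \<in> U" for x
      unfolding islimpt_approachable
    proof (intro allI impI)
      fix e :: real assume "e > 0"
      obtain t g q where x: "x = t - g q" "g \<in> G" "q \<in> T (t, g)" "(t, g) \<in> P"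
        using \<open>x \<in> U\<close> unfolding U_def P_def by auto
      have "B + \<eta> > 0" using \<open>B > 0\<close> \<open>\<eta> > 0\<close> by simp
      then have "e / (B + \<eta>) > 0" using \<open>e > 0\<close> by simp
      then obtain q' where q': "q' \<in> T (t, g)" "q' \<noteq> q" "dist q' q < e / (B + \<eta>)"
        using T(3)[OF x(4) x(3)] unfolding islimpt_approachable by blast
      have q_ball: "q \<in> ball p s" "q' \<in> ball p s" using x q' T(1) cl_S by blast+
      have "norm (g q' - g q) \<le> (B + \<eta>) * dist q' q"
        using lip_g[OF x(2) q_ball(2,1)] by (simp add: dist_norm)
      also have "\<dots> < e" using q'(3) \<open>B + \<eta> > 0\<close> by (simp add: field_simps)
      finally have "dist (t - g q') x < e" unfolding x(1) by (simp add: dist_norm norm_minus_commute)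
      \<comment> \<open>Since \<open>\<eta> < c\<close>, every map in \<open>G\<close> is injective
        on \<open>ball p s\<close>, so distinct survivors give distinct points.\<close>
      moreover have "g q' \<noteq> g q"
      proof
        assume "g q' = g q"
        then have "norm (J (q' - q)) \<le> \<eta> * norm (q' - q)"
          using approx[OF x(2) q_ball(2,1)] by simp
        then have "c * norm (q' - q) \<le> \<eta> * norm (q' - q)" using J(3) order_trans by blast
        then have "c \<le> \<eta>" using q'(2) by simp
        then show False using \<open>c > 0\<close> \<open>d \<ge> 1\<close> unfolding \<eta>_def by (simp add: field_simps)
      qed
      moreover have "t - g q' \<in> U" using x(4) q'(1) unfolding U_def by force
      ultimately show "\<exists>y\<in>U. y \<noteq> x \<and> dist y x < e" using x(1) by (intro bexI[of _ "t - g q'"]) auto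
    qed
    then show "x islimpt K2" if "x \<in> K2" for x
      using that unfolding K2_def limpt_of_closure by (auto simp: closure_def)
  qed
  moreover have "totally_disconnected K2"
    unfolding totally_disconnected_def
  proof
    fix x assume "x \<in> K2"
    have "y = x" if y: "y \<in> connected_component_set K2 x" for y
    proof (rule slant_eqI)
      fix j
      \<comment> \<open>The functional maps the component to a connected set missing all multiples
        of \<open>\<rho> n\<close>. As the spacing can be taken arbitrarily small, the functional is
        constant on the component.\<close>
      have "\<bar>slant k j y - slant k j x\<bar> \<le> inverse (real (Suc m))" for m
      proof -
        obtain n where n: "i n = j" "\<rho> n = inverse (real (Suc m))" using stage by blast
        show ?thesis
          unfolding n(2)[symmetric]
        proof (rule connected_away_from_multiples)
          show "connected (slant k j ` connected_component_set K2 x)"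
            by (intro connected_continuous_image continuous_on_slant connected_connected_component)
          show "away_from_multiples (\<delta> n) (\<rho> n) w" if "w \<in> slant k j ` connected_component_set K2 x" for w
            using that K2_away[of _ n] connected_component_subset[of K2 x] n(1) by blast
        qed (use y \<open>x \<in> K2\<close> \<delta>_pos \<rho>_pos[of n] in auto)
      qed
      moreover have "\<exists>m. inverse (real (Suc m)) < \<bar>slant k j y - slant k j x\<bar>"
        if "slant k j y \<noteq> slant k j x" using that by (intro reals_Archimedean) simp
      ultimately show "slant k j y = slant k j x" by (meson not_le)
    qed
    then show "connected_component_set K2 x = {x}" using \<open>x \<in> K2\<close> by auto
  qed
  ultimately have "cantor_set K2" unfolding cantor_set_def by blast
  moreover have "t \<in> g ` K1 + K2" if "t \<in> ball 0 1" "g \<in> G" for t g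
  proof -
    have tg: "(t, g) \<in> P" using that unfolding P_def by simp
    then obtain q where q: "q \<in> T (t, g)" using T(2) by blast
    then have "q \<in> K1" using T(1)[OF tg] \<open>closure S \<subseteq> K1\<close> by blast
    moreover have "t - g q \<in> K2"
      unfolding K2_def U_def using tg q by (intro closure_subset[THEN subsetD]) force
    ultimately have "g q + (t - g q) \<in> g ` K1 + K2" by (intro set_plus_intro) auto
    then show ?thesis by simp
  qed
  ultimately show ?thesis by blast
qed

theorem theorem1p3:
  fixes R :: "nat \<Rightarrow> (real ^ 'n) set"
    and K1 :: "(real ^ 'n) set"
    and g0 :: "real ^ 'n \<Rightarrow> real ^ 'n"
  assumes "compact_exhaustion R"
    and "cantor_set K1"
    and "g0 \<in> C1_inv"
  shows "\<exists>\<epsilon>>0. \<exists>K2 :: (real ^ 'n) set. cantor_set K2 \<and>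
           interior (\<Inter>g\<in>C1_ball R g0 \<epsilon>. g ` K1 + K2) \<noteq> {}"
proof -
  have g0: "g0 \<in> C1_maps" using assms(3) unfolding C1_inv_def by blast
  obtain p where "p \<in> K1" using assms(2) unfolding cantor_set_def by blast
  define J where "J = (*v) (jacobian g0 (at p))"
  have "linear J" unfolding J_def by (rule matrix_vector_mul_linear)
  moreover have "inj J"
    using assms(3) unfolding J_def C1_inv_def invertible_left_inverse
    by (auto simp flip: matrix_left_invertible_injective)
  ultimately obtain c where c: "c > 0" "\<And>v. c * norm v \<le> norm (J v)"
    using linear_inj_bounded_below_pos by blast
  define \<eta> where "\<eta> = c / (6 * real CARD('n))"
  have "\<eta> > 0" using \<open>c > 0\<close> unfolding \<eta>_def by simp
  then obtain \<epsilon> s where "\<epsilon> > 0" "s > 0" and ball: "\<forall>g\<in>C1_ball R g0 \<epsilon>. norm (g p) \<le> norm (g0 p) + 1 \<and>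
      (\<forall>a\<in>ball p s. \<forall>b\<in>ball p s. norm (g a - g b - J (a - b)) \<le> \<eta> * norm (a - b))"
    using C1_ball_uniformly_almost_linear[OF assms(1) g0, of \<eta> p] unfolding J_def by blast
  \<comment> \<open>\<open>G\<close> records exactly the two estimates shared by the members of the
    metric ball. The affine map \<open>\<lambda>x. J (x - p)\<close> shows that it is nonempty: it
    vanishes at \<open>p\<close> and its linearisation error is zero.\<close>
  define G where "G = {g. norm (g p) \<le> norm (g0 p) + 1 \<and>
      (\<forall>a\<in>ball p s. \<forall>b\<in>ball p s. norm (g a - g b - J (a - b)) \<le> \<eta> * norm (a - b))}"
  have "(\<lambda>x. J (x - p)) \<in> G"
    using \<open>\<eta> > 0\<close> \<open>linear J\<close> unfolding G_def by (simp add: linear_diff linear_0)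
  then have "G \<noteq> {}" by blast
  have "\<exists>K2. cantor_set K2 \<and> ball 0 1 \<subseteq> (\<Inter>g\<in>G. g ` K1 + K2)"
    by (rule cantor_set_plus_covers_ball[OF assms(2) \<open>p \<in> K1\<close> \<open>linear J\<close> c \<open>s > 0\<close> \<open>G \<noteq> {}\<close>])
      (auto simp: G_def \<eta>_def)
  then obtain K2 where K2: "cantor_set K2" "ball 0 1 \<subseteq> (\<Inter>g\<in>G. g ` K1 + K2)" by blast
  have "C1_ball R g0 \<epsilon> \<subseteq> G" using ball unfolding G_def by blast
  then have "ball 0 1 \<subseteq> (\<Inter>g\<in>C1_ball R g0 \<epsilon>. g ` K1 + K2)" using K2(2) by blast
  then have "ball 0 1 \<subseteq> interior (\<Inter>g\<in>C1_ball R g0 \<epsilon>. g ` K1 + K2)"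
    by (rule interior_maximal) simp
  moreover have "(0 :: real ^ 'n) \<in> ball 0 1" by simp
  ultimately show ?thesis using \<open>\<epsilon> > 0\<close> K2(1) by blast
qed

end
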